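(* Let $\boldsymbol f\in\mathbb R^{NM}$ be the degraded image, $\tau\ge 0$, let $p\ge 1$ and let $q$ be its conjugate exponent ($\frac1p+\frac1q=1$), and let $\mathcal C\subseteq\mathbb R^{NM}$ be a convex set representing constraints on the solution (box constraints, with $\mathcal C=\mathbb R^{NM}$ in the unconstrained case), with orthogonal projection operator $P_{\mathcal C}$. Let $\widehat{\boldsymbol J_K}:\mathbb R^{NM}\to\mathcal X=\mathbb R^{N\times LM\times 2}$ be the weighted patch-based Jacobian, $\widehat{\boldsymbol J_K}^{*}$ its adjoint, and $B_{\infty,q}=\{\boldsymbol\Phi\in\mathcal X:\|\boldsymbol\Phi(n)\|_{\mathcal S_q}\le 1,\ \forall n=1,\dots,N\}$. Let $$d(\boldsymbol\Phi)=\min_{\boldsymbol u\in\mathcal C}\Big\{\tfrac12\|\boldsymbol u-\boldsymbol f\|_2^2+\tau\langle\widehat{\boldsymbol J_K}^{*}\boldsymbol\Phi,\boldsymbol u\rangle_2\Big\}=\tfrac12\|\boldsymbol s-P_{\mathcal C}(\boldsymbol s)\|_2^2+\tfrac12\|\boldsymbol f\|_2^2-\tfrac12\|\boldsymbol s\|_2^2,\qquad \boldsymbol s=\boldsymbol f-\tau\widehat{\boldsymbol J_K}^{*}\boldsymbol\Phi .$$ The dual optimization model $$\hat{\boldsymbol\Phi}=\underset{\boldsymbol\Phi\in B_{\infty,q}}{\arg\max}\ d(\boldsymbol\Phi)$$ satisfies the following properties: (1) the objective function $d(\boldsymbol\Phi)$ is convex; (2) the gradient of $d(\boldsymbol\Phi)$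 is Lipschitz continuous with Lipschitz constant $L(d)=8\sqrt2\,\tau^2$; (3) the dual optimization problem is solvable, i.e. $\hat{\boldsymbol\Phi}$ (the set of maximizers of $d$ over $B_{\infty,q}$) is not an empty set.
   Context: Images: $\boldsymbol u=(\boldsymbol u_1,\dots,\boldsymbol u_M)\in\mathbb R^{NM}$ is a vector-valued image with $M$ channels stacked into a vector, each channel having $N$ pixels; $x_i$ denotes the location of pixel $i$. $\nabla\boldsymbol u_m$ is the discrete gradient of channel $m$, obtained by the forward difference operator, with components in the $x$ and $y$ directions. Weights: $\mathcal W$ is the anisotropic weighted matrix $\mathcal W=\operatorname{diag}(\boldsymbol w_1,\boldsymbol w_2)$ with $\boldsymbol w_1=\frac{1}{1+\kappa|\boldsymbol G_{\hat\sigma}*\nabla_x\boldsymbol f|}$ and $\boldsymbol w_2=\frac{1}{1+\kappa|\boldsymbol G_{\hat\sigma}*\nabla_y\boldsymbol f|}$, applied to the discrete gradient (weight $\boldsymbol w_1$ on the $x$ component, $\boldsymbol w_2$ on the $y$ component). Here $\kappa$ and $\hat\sigma$ are parameters, and $\boldsymbol G_{\hat\sigma}*$ denotes Gaussian convolution of variance $\hat\sigma$. Weighted translations: $K$ is a Gaussian convolution kernel with $L=(2L_K+1)^2$ elements, indexed by shifts $g_l\in\{-L_K,\dots,L_K\}^2$, $l=1,\dots,L$. The weighted translation operator $\Psi_l$ is defined by $(\Psi_l\nabla\boldsymbol u_m)(i)=\sqrt{K[g_l]}\,(\nabla\boldsymbol u_m)(x_i-g_l)$, and it acts in the same way on $\mathcal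 W\nabla\boldsymbol u_m$. Weighted patch-based Jacobian: for each pixel $i$, $(\widehat{\boldsymbol J_K}\boldsymbol u)(i)=[\widehat\nabla\boldsymbol u_1(i),\dots,\widehat\nabla\boldsymbol u_M(i)]^T\in\mathbb R^{LM\times 2}$, where $\widehat\nabla\boldsymbol u_m(i)=[(\Psi_1\mathcal W\nabla\boldsymbol u_m)(i),\dots,(\Psi_L\mathcal W\nabla\boldsymbol u_m)(i)]$. Thus row $h=(m-1)L+l$ of $(\widehat{\boldsymbol J_K}\boldsymbol u)(i)$ is $(\Psi_l\mathcal W\nabla\boldsymbol u_m)(i)$. Inner products and norms: an element $\boldsymbol\Phi\in\mathcal X$ consists of $N$ submatrices $\boldsymbol\Phi(n)\in\mathbb R^{LM\times2}$; $\langle\boldsymbol\Lambda,\boldsymbol\Upsilon\rangle_{\mathcal X}=\sum_{n=1}^N\operatorname{trace}(\boldsymbol\Upsilon(n)^T\boldsymbol\Lambda(n))$ and $\|\boldsymbol\Upsilon\|_{\mathcal X}=\sqrt{\langle\boldsymbol\Upsilon,\boldsymbol\Upsilon\rangle_{\mathcal X}}$. $\|\cdot\|_{\mathcal S_q}$ is the Schatten norm of order $q$ (the $\ell_q$ norm of the singular values). $\langle\cdot,\cdot\rangle_2$ and $\|\cdot\|_2$ are the Euclidean inner product and norm on $\mathbb R^{NM}$. The adjoint $\widehat{\boldsymbol J_K}^{*}:\mathcal X\to\mathbb R^{NM}$ satisfies $\langle\boldsymbol\Phi,\widehat{\boldsymbol J_K}\boldsymbol u\rangle_{\mathcal X}=\langle\widehat{\boldsymbol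 J_K}^{*}\boldsymbol\Phi,\boldsymbol u\rangle_2$. The gradient of $d$ is $\nabla d(\boldsymbol\Phi)=\tau\widehat{\boldsymbol J_K}P_{\mathcal C}(\boldsymbol f-\tau\widehat{\boldsymbol J_K}^{*}\boldsymbol\Phi)$.
   Formalization: Property (1) is corrected: d is proved concave (−d convex), as d is not convex in general; C is also taken closed and nonempty so P_C exists, K is normalised to sum 1, and the boundary rule is zero, periodic or symmetric. *)

theory Defs
  imports "HOL-Analysis.Analysis"
begin

text \<open>
  A channel is a vector in \<open>real^'n\<close> (\<open>'n\<close> = pixels), an image with channels \<open>'m\<close> is a vector in
  \<open>real^'n^'m\<close>, whose inner product and norm are the Euclidean ones of the stacked vector.
  The pixel locations are given by a map \<open>x :: 'n \<Rightarrow> int \<times> int\<close> onto a rectangle.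
  An element of the space \<open>X\<close> is a vector \<open>\<Phi> :: real^2^('m \<times> 'l)^'n\<close>: for every pixel \<open>n\<close> a matrix
  \<open>\<Phi> $ n\<close> with two columns and with rows indexed by (channel, shift).
\<close>

section \<open>Boundary rules\<close>

text \<open>
  Differences, translations and convolutions refer to locations outside of the image.
  \<open>Symmetric\<close> is the half-sample reflection \<open>\<dots> v 1, v 0 | v 0, v 1, \<dots>, v (n-1) | v (n-1), v (n-2) \<dots>\<close>;
  with it the forward difference at the far border is zero (Neumann condition).
\<close>

datatype boundary = Zero | Periodic | Symmetric

fun fold_coord :: "boundary \<Rightarrow> int \<Rightarrow> int \<Rightarrow> int" where
  "fold_coord Zero n a = a"
| "fold_coord Periodic n a = a mod n"
| "fold_coord Symmetric n a = (let r = a mod (2 * n) in if r < n then r else 2 * n - 1 - r)"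

definition extend ::
  "boundary \<Rightarrow> int \<times> int \<Rightarrow> ('n::finite \<Rightarrow> int \<times> int) \<Rightarrow> real^'n \<Rightarrow> int \<times> int \<Rightarrow> real" where
  "extend b dims x v z =
     (let z' = (fold_coord b (fst dims) (fst z), fold_coord b (snd dims) (snd z))
      in if z' \<in> range x then v $ (inv x z') else 0)"

text \<open>
  In the following \<open>Ed\<close> is the extension used by the differences and \<open>Ef\<close> the one used by
  the translations and the Gaussian filter.
\<close>

section \<open>Weighted gradient\<close>

definition dgrad ::
  "(real^'n \<Rightarrow> int \<times> int \<Rightarrow> real) \<Rightarrow> ('n::finite \<Rightarrow> int \<times> int) \<Rightarrow> real^'n \<Rightarrow> real^2^'n" where
  "dgrad Ed x v = (\<chi> i. vector [Ed v (x i + (1, 0)) - v $ i, Ed v (x i + (0, 1)) - v $ i])"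

definition component :: "real^2^'n \<Rightarrow> 2 \<Rightarrow> real^'n::finite" where
  "component F c = (\<chi> i. F $ i $ c)"

text \<open>The parameter of \<open>gauss\<close> is the variance.\<close>

definition gauss :: "real \<Rightarrow> int \<times> int \<Rightarrow> real" where
  "gauss \<rho> g = exp (- (real_of_int (fst g)^2 + real_of_int (snd g)^2) / (2 * \<rho>)) / (2 * pi * \<rho>)"

definition smooth ::
  "real \<Rightarrow> (real^'n \<Rightarrow> int \<times> int \<Rightarrow> real) \<Rightarrow> ('n::finite \<Rightarrow> int \<times> int) \<Rightarrow> real^'n \<Rightarrow> real^'n" where
  "smooth \<rho> Ef x v = (\<chi> i. \<Sum>\<^sub>\<infinity>g. gauss \<rho> g * Ef v (x i - g))"

text \<open>
  Column 1 of \<open>weight\<close> is the diagonal \<open>w\<^sub>1\<close>, column 2 the diagonal \<open>w\<^sub>2\<close>; both are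
  computed from a channel \<open>v\<close> of the degraded image.
\<close>

definition weight ::
  "real \<Rightarrow> real \<Rightarrow> (real^'n \<Rightarrow> int \<times> int \<Rightarrow> real) \<Rightarrow> (real^'n \<Rightarrow> int \<times> int \<Rightarrow> real) \<Rightarrow>
   ('n::finite \<Rightarrow> int \<times> int) \<Rightarrow> real^'n \<Rightarrow> real^2^'n" where
  "weight \<kappa> \<rho> Ed Ef x v =
     (\<chi> i c. 1 / (1 + \<kappa> * \<bar>smooth \<rho> Ef x (component (dgrad Ed x v) c) $ i\<bar>))"

definition apply_weight :: "real^2^'n \<Rightarrow> real^2^'n \<Rightarrow> real^2^'n::finite" where
  "apply_weight W F = (\<chi> i c. W $ i $ c * F $ i $ c)"

section \<open>Weighted patch-based Jacobian\<close>

definition patch :: "nat \<Rightarrow> (int \<times> int) set" where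
  "patch LK = {- int LK .. int LK} \<times> {- int LK .. int LK}"

text \<open>As usual for truncated Gaussian kernels, the entries are normalised to sum 1.\<close>

definition patch_kernel :: "real \<Rightarrow> nat \<Rightarrow> int \<times> int \<Rightarrow> real" where
  "patch_kernel \<rho> LK g = gauss \<rho> g / (\<Sum>h\<in>patch LK. gauss \<rho> h)"

definition wtranslate ::
  "(int \<times> int \<Rightarrow> real) \<Rightarrow> int \<times> int \<Rightarrow> (real^'n \<Rightarrow> int \<times> int \<Rightarrow> real) \<Rightarrow>
   ('n::finite \<Rightarrow> int \<times> int) \<Rightarrow> real^2^'n \<Rightarrow> real^2^'n" where
  "wtranslate K g Ef x F = (\<chi> i c. sqrt (K g) * Ef (component F c) (x i - g))"

definition wjacobian ::
  "real \<Rightarrow> real \<Rightarrow> (int \<times> int \<Rightarrow> real) \<Rightarrow> ('l::finite \<Rightarrow> int \<times> int) \<Rightarrow>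
   (real^'n \<Rightarrow> int \<times> int \<Rightarrow> real) \<Rightarrow> (real^'n \<Rightarrow> int \<times> int \<Rightarrow> real) \<Rightarrow> ('n::finite \<Rightarrow> int \<times> int) \<Rightarrow>
   real^'n^'m::finite \<Rightarrow> real^'n^'m \<Rightarrow> real^2^('m \<times> 'l)^'n" where
  "wjacobian \<kappa> \<rho> K g Ed Ef x f u =
     (\<chi> i h. case h of (m, l) \<Rightarrow>
        wtranslate K (g l) Ef x
          (apply_weight (weight \<kappa> \<rho> Ed Ef x (f $ m)) (dgrad Ed x (u $ m))) $ i)"

lemma inner_eq_sum_trace:
  fixes \<Lambda> \<Upsilon> :: "real^2^'h^'n"
  shows "\<Lambda> \<bullet> \<Upsilon> = (\<Sum>n\<in>UNIV. trace (transpose (\<Upsilon> $ n) ** (\<Lambda> $ n)))"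
proof -
  have "\<Lambda> $ n \<bullet> \<Upsilon> $ n = trace (transpose (\<Upsilon> $ n) ** (\<Lambda> $ n))" for n
    unfolding inner_vec_def trace_def matrix_matrix_mult_def transpose_def
    by (simp add: mult.commute) (rule sum.swap)
  then show ?thesis
    by (simp add: inner_vec_def[of \<Lambda>])
qed

section \<open>Schatten norms\<close>

definition singular_values :: "real^'c^'r \<Rightarrow> real set" where
  "singular_values A = {s. 0 \<le> s \<and> (\<exists>v. v \<noteq> 0 \<and> (transpose A ** A) *v v = s\<^sup>2 *\<^sub>R v)}"

definition singular_mult :: "real^'c^'r \<Rightarrow> real \<Rightarrow> nat" where
  "singular_mult A s = dim {v. (transpose A ** A) *v v = s\<^sup>2 *\<^sub>R v}"

text \<open>
  There may be more zero singular values here than \<open>min CARD('r) CARD('c)\<close> allows, which does not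
  affect the norm.
\<close>

definition schatten_norm :: "ennreal \<Rightarrow> real^'c^'r \<Rightarrow> real" where
  "schatten_norm q A =
     (if q = \<infinity> then Max (singular_values A)
      else (\<Sum>s\<in>singular_values A. real (singular_mult A s) * s powr enn2real q)
             powr (1 / enn2real q))"

definition schatten_ball :: "ennreal \<Rightarrow> (real^'c^'r^'n) set" where
  "schatten_ball q = {\<Phi>. \<forall>n. schatten_norm q (\<Phi> $ n) \<le> 1}"

lemma finite_singular_values: "finite (singular_values (A :: real^'c^'r))"
proof -
  let ?M = "transpose A ** A"
  define v where "v s = (SOME v. v \<noteq> 0 \<and> ?M *v v = s\<^sup>2 *\<^sub>R v)" for s :: real
  have v: "v s \<noteq> 0" "?M *v v s = s\<^sup>2 *\<^sub>R v s" if "s \<in> singular_values A" for s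
    using that someI_ex[of "\<lambda>v. v \<noteq> 0 \<and> ?M *v v = s\<^sup>2 *\<^sub>R v"]
    unfolding v_def singular_values_def by blast+
  have sym: "(?M *v a) \<bullet> b = a \<bullet> (?M *v b)" for a b
    by (metis dot_lmul_matrix matrix_transpose_mul transpose_matrix_vector transpose_transpose)
  have orth: "v s \<bullet> v t = 0"
    if "s \<in> singular_values A" "t \<in> singular_values A" "s \<noteq> t" for s t
  proof -
    have "s\<^sup>2 * (v s \<bullet> v t) = t\<^sup>2 * (v s \<bullet> v t)"
      using sym[of "v s" "v t"] v that by simp
    moreover have "s\<^sup>2 \<noteq> t\<^sup>2"
      using that by (auto simp: singular_values_def power2_eq_iff)
    ultimately show ?thesis by simp
  qed
  have inj: "inj_on v (singular_values A)"
    by (rule inj_onI) (metis orth v(1) inner_eq_zero_iff)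
  have "independent (v ` singular_values A)"
    by (rule pairwise_orthogonal_independent)
       (auto simp: pairwise_def orthogonal_def intro: orth dest: v(1))
  then have "finite (v ` singular_values A)"
    by (rule independent_imp_finite)
  with inj show ?thesis
    by (simp add: finite_image_iff)
qed

section \<open>Dual problem\<close>

definition lagrangian ::
  "('a::euclidean_space \<Rightarrow> 'b::euclidean_space) \<Rightarrow> real \<Rightarrow> 'a \<Rightarrow> 'b \<Rightarrow> 'a \<Rightarrow> real" where
  "lagrangian J \<tau> f \<Phi> u = 1 / 2 * (norm (u - f))\<^sup>2 + \<tau> * (adjoint J \<Phi> \<bullet> u)"

definition dual_objective ::
  "('a::euclidean_space \<Rightarrow> 'b::euclidean_space) \<Rightarrow> real \<Rightarrow> 'a \<Rightarrow> 'a set \<Rightarrow> 'b \<Rightarrow> real" where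
  "dual_objective J \<tau> f C \<Phi> = (INF u\<in>C. lagrangian J \<tau> f \<Phi> u)"

definition dual_gradient ::
  "('a::euclidean_space \<Rightarrow> 'b::euclidean_space) \<Rightarrow> real \<Rightarrow> 'a \<Rightarrow> 'a set \<Rightarrow> 'b \<Rightarrow> 'b" where
  "dual_gradient J \<tau> f C \<Phi> = \<tau> *\<^sub>R J (closest_point C (f - \<tau> *\<^sub>R adjoint J \<Phi>))"

end

theory Submission
  imports Defs
begin

text \<open>
  Completing the square shows that the Lagrangian at \<open>\<Phi>\<close> is minimised over \<open>C\<close> by the projection of
  \<open>f - \<tau> *\<^sub>R adjoint J \<Phi>\<close>, which gives the closed form of \<open>d\<close>. As an infimum of functions that are
  affine in \<open>\<Phi>\<close>, \<open>d\<close> is concave (the convexity of the maximisation problem), and each minimiser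
  provides a supergradient, namely \<open>dual_gradient J \<tau> f C \<Phi>\<close> (\<open>dual_objective_supergradient\<close>). The
  supergradient depends on \<open>\<Phi>\<close> through \<open>J\<close>, a nonexpansive projection and \<open>adjoint J\<close>, so it is
  Lipschitz continuous with a constant \<open>\<tau>\<^sup>2\<close> times the squared norm of \<open>J\<close>
  (\<open>lipschitz_dual_gradient\<close>), and a Lipschitz continuous supergradient is a gradient
  (\<open>gderiv_if_supergradient_lipschitz\<close>).

  The squared norm of \<open>J\<close> is at most \<open>8\<close>, hence below \<open>8 * sqrt 2\<close> (\<open>norm_wjacobian_le\<close>). Forward
  differences contribute \<open>4\<close> for each direction, the weights are at most \<open>1\<close>, and the patch average
  does not increase the norm. The last point is delicate for the reflecting boundary rule, where a
  single translation can read pixels near the border twice. There the symmetry of the Gaussian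
  kernel is essential: a shift and its opposite together read every pixel exactly twice
  (\<open>sum_extend1_Symmetric_shift_pair\<close>), so that the average over the patch has norm at most \<open>1\<close>.

  Finally, \<open>d\<close> is continuous, and the Schatten ball is compact and contains \<open>0\<close>, so a maximiser
  exists. Compactness is not immediate from a norm that is defined by singular values and the
  dimensions of eigenspaces. The matrices have only two columns, so the eigenvalues of the Gram
  matrix are given by the quadratic formula, and they depend continuously on the matrix
  (\<open>compact_schatten_ball_2\<close>).
\<close>

section \<open>Shifts and differences on an interval\<close>

text \<open>
  The one-coordinate analogue of \<open>extend\<close>; a boundary rule on the grid is this rule applied to
  each of the two coordinates.
\<close>

definition extend1 :: "boundary \<Rightarrow> int \<Rightarrow> (int \<Rightarrow> real) \<Rightarrow> int \<Rightarrow> real" where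
  "extend1 b n h z = (let r = fold_coord b n z in if r \<in> {0..<n} then h r else 0)"

lemma bij_betw_shift_mod:
  fixes n s :: int
  assumes "n > 0"
  shows "bij_betw (\<lambda>z. (z - s) mod n) {0..<n} {0..<n}"
proof (rule bij_betw_byWitness[where f' = "\<lambda>z. (z + s) mod n"])
  show "\<forall>a\<in>{0..<n}. ((a - s) mod n + s) mod n = a"
    by (simp add: mod_add_left_eq)
  show "\<forall>a\<in>{0..<n}. ((a + s) mod n - s) mod n = a"
    by (simp add: mod_diff_left_eq)
qed (use assms in auto)

lemma sum_extend1_Zero_shift_le:
  assumes "\<And>z. h z \<ge> 0"
  shows "(\<Sum>z\<in>{0..<n}. extend1 Zero n h (z - s)) \<le> (\<Sum>z\<in>{0..<n}. h z)"
proof -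
  have "(\<Sum>z\<in>{0..<n}. extend1 Zero n h (z - s)) = (\<Sum>z\<in>(\<lambda>z. z - s) ` {0..<n}. extend1 Zero n h z)"
    by (subst sum.reindex) (auto simp: inj_on_def)
  also have "\<dots> = (\<Sum>z\<in>(\<lambda>z. z - s) ` {0..<n} \<inter> {0..<n}. h z)"
    by (intro sum.mono_neutral_cong_right) (auto simp: extend1_def)
  also have "\<dots> \<le> (\<Sum>z\<in>{0..<n}. h z)"
    by (intro sum_mono2) (auto intro: assms)
  finally show ?thesis .
qed

lemma sum_extend1_Periodic_shift:
  assumes "n > 0"
  shows "(\<Sum>z\<in>{0..<n}. extend1 Periodic n h (z - s)) = (\<Sum>z\<in>{0..<n}. h z)"
proof -
  have "(\<Sum>z\<in>{0..<n}. extend1 Periodic n h (z - s)) = (\<Sum>z\<in>{0..<n}. h ((z - s) mod n))"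
    using assms by (simp add: extend1_def)
  also have "\<dots> = (\<Sum>z\<in>{0..<n}. h z)"
    by (rule sum.reindex_bij_betw[OF bij_betw_shift_mod[OF assms]])
  finally show ?thesis .
qed

lemma fold_coord_Symmetric_reflect:
  assumes "n > 0"
  shows "fold_coord Symmetric n (2 * n - 1 - z) = fold_coord Symmetric n z"
proof -
  define r where "r = z mod (2 * n)"
  have r: "0 \<le> r" "r < 2 * n"
    using assms by (simp_all add: r_def)
  have "(2 * n - 1 - z) mod (2 * n) = (2 * n - 1 - r) mod (2 * n)"
    by (simp add: r_def mod_diff_right_eq)
  also have "\<dots> = 2 * n - 1 - r"
    using r by (simp add: mod_pos_pos_trivial)
  finally show ?thesis
    using r by (simp add: Let_def flip: r_def)
qed

text \<open>
  Under reflection a single shift may use pixels twice: for \<open>s = 1\<close> and \<open>n > 1\<close> the value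
  \<open>h 0\<close> is read twice and \<open>h (n - 1)\<close> not at all. The opposite shift compensates exactly. Indeed the extension is even about \<open>-1/2\<close> and has period \<open>2 * n\<close>, so the two sums
  together run over one full period, in which every pixel occurs twice.
\<close>

lemma sum_extend1_Symmetric_shift_pair:
  assumes n: "n > 0"
  shows "(\<Sum>z\<in>{0..<n}. extend1 Symmetric n h (z - s)) + (\<Sum>z\<in>{0..<n}. extend1 Symmetric n h (z + s))
       = 2 * (\<Sum>z\<in>{0..<n}. h z)"
proof -
  let ?e = "extend1 Symmetric n h"
  have split: "(\<Sum>z\<in>{0..<2 * n}. \<phi> z) = (\<Sum>z\<in>{0..<n}. \<phi> z) + (\<Sum>z\<in>{0..<n}. \<phi> (2 * n - 1 - z))"
    for \<phi> :: "int \<Rightarrow> real"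
  proof -
    have "{0..<2 * n} = {0..<n} \<union> {n..<2 * n}" using n by auto
    then have "(\<Sum>z\<in>{0..<2 * n}. \<phi> z) = (\<Sum>z\<in>{0..<n}. \<phi> z) + (\<Sum>z\<in>{n..<2 * n}. \<phi> z)"
      by (simp add: sum.union_disjoint)
    also have "(\<Sum>z\<in>{n..<2 * n}. \<phi> z) = (\<Sum>z\<in>{0..<n}. \<phi> (2 * n - 1 - z))"
      by (rule sum.reindex_bij_witness[where i = "\<lambda>z. 2 * n - 1 - z" and j = "\<lambda>z. 2 * n - 1 - z"]) auto
    finally show ?thesis .
  qed
  have reflect: "?e (2 * n - 1 - z) = ?e z" for z
    unfolding extend1_def fold_coord_Symmetric_reflect[OF n] ..
  have e_mod: "?e z = ?e (z mod (2 * n))" for z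
    by (simp add: extend1_def)
  have inside: "?e z = h z" if "z \<in> {0..<n}" for z
    using that by (simp add: extend1_def mod_pos_pos_trivial)
  \<comment> \<open>Reflection turns the shift by \<open>- s\<close> into the shift by \<open>s\<close> over the other half of the period.\<close>
  have "?e (z + s) = ?e (2 * n - 1 - z - s)" for z
    using reflect[of "z + s"] by (simp add: algebra_simps)
  then have "(\<Sum>z\<in>{0..<n}. ?e (z - s)) + (\<Sum>z\<in>{0..<n}. ?e (z + s)) = (\<Sum>z\<in>{0..<2 * n}. ?e (z - s))"
    by (simp add: split)
  also have "\<dots> = (\<Sum>z\<in>{0..<2 * n}. ?e ((z - s) mod (2 * n)))"
    by (simp flip: e_mod)
  also have "\<dots> = (\<Sum>z\<in>{0..<2 * n}. ?e z)"
    using n by (intro sum.reindex_bij_betw[OF bij_betw_shift_mod]) simp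
  also have "\<dots> = 2 * (\<Sum>z\<in>{0..<n}. h z)"
    by (simp add: split reflect inside)
  finally show ?thesis .
qed

text \<open>
  The form in which all three boundary rules agree. For \<open>Zero\<close> some values are lost, hence an
  inequality.
\<close>

lemma sum_extend1_shift_pair_le:
  assumes "\<And>z. h z \<ge> 0" "n > 0"
  shows "(\<Sum>z\<in>{0..<n}. extend1 b n h (z - s)) + (\<Sum>z\<in>{0..<n}. extend1 b n h (z + s))
       \<le> 2 * (\<Sum>z\<in>{0..<n}. h z)"
proof (cases b)
  case Zero
  then show ?thesis
    using sum_extend1_Zero_shift_le[of h n s] sum_extend1_Zero_shift_le[of h n "- s"] assms by simp
next
  case Periodic
  then show ?thesis
    using sum_extend1_Periodic_shift[of n h s] sum_extend1_Periodic_shift[of n h "- s"] assms by simp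
next
  case Symmetric
  then show ?thesis
    using sum_extend1_Symmetric_shift_pair[of n h s] assms by simp
qed

text \<open>
  Pairing \<open>s\<close> with \<open>- s\<close> needs equal weights at both: this is where the symmetry of the Gaussian
  kernel enters.
\<close>

lemma sum_even_weight_extend1_le:
  fixes k :: "int \<Rightarrow> real"
  assumes h: "\<And>z. h z \<ge> 0" and n: "n > 0"
    and k: "\<And>s. k s \<ge> 0" "\<And>s. k (- s) = k s"
  shows "(\<Sum>s\<in>{- a..a}. k s * (\<Sum>z\<in>{0..<n}. extend1 b n h (z - s)))
       \<le> (\<Sum>s\<in>{- a..a}. k s) * (\<Sum>z\<in>{0..<n}. h z)"
proof -
  define G where "G s = (\<Sum>z\<in>{0..<n}. extend1 b n h (z - s))" for s
  have flip: "(\<Sum>s\<in>{- a..a}. k s * G (- s)) = (\<Sum>s\<in>{- a..a}. k s * G s)"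
    by (rule sum.reindex_bij_witness[where i = uminus and j = uminus]) (auto simp: k)
  have "2 * (\<Sum>s\<in>{- a..a}. k s * G s) = (\<Sum>s\<in>{- a..a}. k s * (G s + G (- s)))"
    using flip by (simp add: distrib_left sum.distrib)
  also have "\<dots> \<le> (\<Sum>s\<in>{- a..a}. k s * (2 * (\<Sum>z\<in>{0..<n}. h z)))"
    unfolding G_def using sum_extend1_shift_pair_le[of h n b] h n
    by (intro sum_mono mult_left_mono k) simp
  also have "\<dots> = 2 * ((\<Sum>s\<in>{- a..a}. k s) * (\<Sum>z\<in>{0..<n}. h z))"
    by (subst sum_distrib_right[symmetric]) simp
  finally show ?thesis by (simp add: G_def)
qed

text \<open>
  Since \<open>(s - t)\<^sup>2 \<le> 2 * s\<^sup>2 + 2 * t\<^sup>2\<close>, and each value occurs in two differences, the constant is \<open>4\<close>.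
  Only the last difference depends on the boundary rule. It may use the part of the budget that the
  interior differences leave, \<open>2 * (h 0)\<^sup>2 + 2 * (h (n - 1))\<^sup>2\<close>; in particular the reflected
  value makes it vanish instead of counting the last pixel twice.
\<close>

lemma sum_extend1_forward_diff_le:
  assumes n: "n > 0"
  shows "(\<Sum>z\<in>{0..<n}. (extend1 b n h (z + 1) - h z)\<^sup>2) \<le> 4 * (\<Sum>z\<in>{0..<n}. (h z)\<^sup>2)"
proof -
  have sq: "(s - t)\<^sup>2 \<le> 2 * s\<^sup>2 + 2 * t\<^sup>2" for s t :: real
    using zero_le_power2[of "s + t"] by (simp add: power2_eq_square algebra_simps)
  have last: "{0..<n} = insert (n - 1) {0..<n - 1}" using n by auto
  have first: "{0..<n} = insert 0 {1..<n}" using n by auto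
  have shift: "(\<Sum>z\<in>{0..<n - 1}. (h (z + 1))\<^sup>2) = (\<Sum>z\<in>{1..<n}. (h z)\<^sup>2)"
    by (rule sum.reindex_bij_witness[where i = "\<lambda>z. z - 1" and j = "\<lambda>z. z + 1"]) auto
  have inside: "extend1 b n h z = h z" if "z \<in> {0..<n}" for z
    using that by (cases b) (simp_all add: extend1_def mod_pos_pos_trivial)
  have border: "(extend1 b n h n - h (n - 1))\<^sup>2 \<le> 2 * (h 0)\<^sup>2 + 2 * (h (n - 1))\<^sup>2"
  proof (cases b)
    case Symmetric
    moreover have "n mod (2 * n) = n" using n by (intro mod_pos_pos_trivial) auto
    ultimately show ?thesis using n by (simp add: extend1_def)
  qed (use n sq[of "h 0" "h (n - 1)"] in \<open>simp_all add: extend1_def\<close>)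
  have "(\<Sum>z\<in>{0..<n - 1}. (extend1 b n h (z + 1) - h z)\<^sup>2)
      = (\<Sum>z\<in>{0..<n - 1}. (h (z + 1) - h z)\<^sup>2)"
    by (intro sum.cong) (auto simp: inside)
  also have "\<dots> \<le> (\<Sum>z\<in>{0..<n - 1}. 2 * (h (z + 1))\<^sup>2 + 2 * (h z)\<^sup>2)"
    by (intro sum_mono sq)
  also have "\<dots> = 2 * (\<Sum>z\<in>{1..<n}. (h z)\<^sup>2) + 2 * (\<Sum>z\<in>{0..<n - 1}. (h z)\<^sup>2)"
    by (simp add: sum.distrib shift flip: sum_distrib_left)
  finally have "(\<Sum>z\<in>{0..<n}. (extend1 b n h (z + 1) - h z)\<^sup>2)
      \<le> 2 * ((h 0)\<^sup>2 + (\<Sum>z\<in>{1..<n}. (h z)\<^sup>2)) + 2 * ((h (n - 1))\<^sup>2 + (\<Sum>z\<in>{0..<n - 1}. (h z)\<^sup>2))"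
    unfolding last using border by simp
  also have "(h 0)\<^sup>2 + (\<Sum>z\<in>{1..<n}. (h z)\<^sup>2) = (\<Sum>z\<in>{0..<n}. (h z)\<^sup>2)"
    unfolding first by simp
  also have "(h (n - 1))\<^sup>2 + (\<Sum>z\<in>{0..<n - 1}. (h z)\<^sup>2) = (\<Sum>z\<in>{0..<n}. (h z)\<^sup>2)"
    unfolding last by simp
  finally show ?thesis by simp
qed

section \<open>Norm of the patch-based Jacobian\<close>

lemma extend_eq_extend1:
  fixes x :: "'n::finite \<Rightarrow> int \<times> int"
  assumes "bij_betw x UNIV ({0..<n1} \<times> {0..<n2})"
  shows "extend b (n1, n2) x v z =
    extend1 b n1 (\<lambda>c. extend1 b n2 (\<lambda>r. v $ inv x (c, r)) (snd z)) (fst z)"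
  using assms by (auto simp: extend_def extend1_def Let_def bij_betw_def)

lemma extend1_power2: "(extend1 b n h z)\<^sup>2 = extend1 b n (\<lambda>a. (h a)\<^sup>2) z"
  by (simp add: extend1_def Let_def)

lemma extend1_nonneg:
  assumes "\<And>z. h z \<ge> 0"
  shows "extend1 b n h z \<ge> 0"
  using assms by (simp add: extend1_def Let_def)

text \<open>
  The coordinates are treated in turn: for a fixed vertical shift the weights are even in the
  horizontal one, and what remains after summing over it is again even in the vertical one.
\<close>

lemma sum_even_weight_extend1_2d_le:
  fixes k :: "int \<Rightarrow> int \<Rightarrow> real"
  assumes h: "\<And>c r. h c r \<ge> 0" and n: "n1 > 0" "n2 > 0"
    and k: "\<And>s t. k s t \<ge> 0" "\<And>s t. k (- s) t = k s t" "\<And>s t. k s (- t) = k s t"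
  shows "(\<Sum>s\<in>{- a..a}. \<Sum>t\<in>{- a..a}. k s t *
            (\<Sum>c\<in>{0..<n1}. \<Sum>r\<in>{0..<n2}. extend1 b n1 (\<lambda>c. extend1 b n2 (h c) (r - t)) (c - s)))
       \<le> (\<Sum>s\<in>{- a..a}. \<Sum>t\<in>{- a..a}. k s t) * (\<Sum>c\<in>{0..<n1}. \<Sum>r\<in>{0..<n2}. h c r)"
    (is "?lhs \<le> ?rhs")
proof -
  let ?A = "{- a..a}" and ?C = "{0..<n1}" and ?R = "{0..<n2}"
  let ?H = "\<lambda>c y. extend1 b n2 (h c) y"
  have "?lhs = (\<Sum>t\<in>?A. \<Sum>s\<in>?A. k s t *
      (\<Sum>c\<in>?C. \<Sum>r\<in>?R. extend1 b n1 (\<lambda>c. ?H c (r - t)) (c - s)))"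
    by (rule sum.swap)
  also have "\<dots> = (\<Sum>t\<in>?A. \<Sum>s\<in>?A. \<Sum>r\<in>?R. k s t *
      (\<Sum>c\<in>?C. extend1 b n1 (\<lambda>c. ?H c (r - t)) (c - s)))"
    by (simp add: sum_distrib_left sum.swap[of _ ?R ?C])
  also have "\<dots> = (\<Sum>t\<in>?A. \<Sum>r\<in>?R. \<Sum>s\<in>?A. k s t *
      (\<Sum>c\<in>?C. extend1 b n1 (\<lambda>c. ?H c (r - t)) (c - s)))"
    by (simp only: sum.swap[of _ ?R ?A])
  also have "\<dots> \<le> (\<Sum>t\<in>?A. \<Sum>r\<in>?R. (\<Sum>s\<in>?A. k s t) * (\<Sum>c\<in>?C. ?H c (r - t)))"
    using k n h by (intro sum_mono sum_even_weight_extend1_le extend1_nonneg) auto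
  also have "\<dots> = (\<Sum>c\<in>?C. \<Sum>t\<in>?A. (\<Sum>s\<in>?A. k s t) * (\<Sum>r\<in>?R. ?H c (r - t)))"
    by (simp add: sum_distrib_left sum.swap[of _ ?R ?C] sum.swap[of _ ?A ?C])
  also have "\<dots> \<le> (\<Sum>c\<in>?C. (\<Sum>t\<in>?A. \<Sum>s\<in>?A. k s t) * (\<Sum>r\<in>?R. h c r))"
    using k n h by (intro sum_mono sum_even_weight_extend1_le sum_nonneg) auto
  also have "\<dots> = ?rhs"
    by (subst sum.swap[of _ ?A ?A]) (simp add: sum_distrib_left)
  finally show ?thesis .
qed

lemma sum_pixels:
  assumes "bij_betw x (UNIV :: 'n set) ({0..<n1} \<times> {0..<n2})"
  shows "(\<Sum>i\<in>UNIV. \<phi> (x i)) = (\<Sum>c\<in>{0..<n1::int}. \<Sum>r\<in>{0..<n2::int}. \<phi> (c, r))"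
  using sum.reindex_bij_betw[OF assms, of \<phi>] by (simp add: sum.cartesian_product)

lemma norm_vec_power2: "(norm (v :: real^'n))\<^sup>2 = (\<Sum>i\<in>UNIV. (v $ i)\<^sup>2)"
  by (simp add: norm_vec_def L2_set_def sum_nonneg)

lemma pixel_grid_nonempty:
  assumes "bij_betw x (UNIV :: 'n set) ({0..<n1} \<times> {0..<n2})"
  shows "n1 > (0::int)" "n2 > (0::int)"
proof -
  have "x undefined \<in> {0..<n1} \<times> {0..<n2}"
    using assms by (auto simp: bij_betw_def)
  then show "n1 > 0" "n2 > 0" by auto
qed

lemma
  assumes "\<rho> > 0"
  shows patch_kernel_nonneg: "patch_kernel \<rho> LK g \<ge> 0"
    and sum_patch_kernel: "(\<Sum>h\<in>patch LK. patch_kernel \<rho> LK h) = 1"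
proof -
  have pos: "gauss \<rho> h > 0" for h
    using assms by (simp add: gauss_def)
  show "patch_kernel \<rho> LK g \<ge> 0"
    unfolding patch_kernel_def by (intro divide_nonneg_nonneg sum_nonneg less_imp_le[OF pos])
  have "(\<Sum>h\<in>patch LK. gauss \<rho> h) > 0"
    using pos by (intro sum_pos) (auto simp: patch_def)
  then show "(\<Sum>h\<in>patch LK. patch_kernel \<rho> LK h) = 1"
    by (simp add: patch_kernel_def flip: sum_divide_distrib)
qed

lemma patch_kernel_even:
  "patch_kernel \<rho> LK (- s, t) = patch_kernel \<rho> LK (s, t)"
  "patch_kernel \<rho> LK (s, - t) = patch_kernel \<rho> LK (s, t)"
  by (simp_all add: patch_kernel_def gauss_def)

text \<open>
  The kernel has total mass \<open>1\<close>, so averaging over the patch does not increase the norm. For reflected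
  images an individual translation may increase it; the estimate needs opposite shifts together.
\<close>

lemma sum_patch_translations_le:
  fixes v :: "real^'n::finite" and x :: "'n \<Rightarrow> int \<times> int"
  assumes x: "bij_betw x UNIV ({0..<n1} \<times> {0..<n2})"
    and g: "bij_betw g UNIV (patch LK)" and \<rho>: "\<rho> > 0"
  shows "(\<Sum>l\<in>UNIV. patch_kernel \<rho> LK (g l) * (\<Sum>i\<in>UNIV. (extend b (n1, n2) x v (x i - g l))\<^sup>2))
       \<le> (norm v)\<^sup>2"
proof -
  let ?K = "patch_kernel \<rho> LK" and ?A = "{- int LK..int LK}"
  define h where "h c r = (v $ inv x (c, r))\<^sup>2" for c r
  have inv: "inv x (x i) = i" for i
    using x by (simp add: bij_betw_def inv_f_f)
  have "(norm v)\<^sup>2 = (\<Sum>i\<in>UNIV. (v $ inv x (x i))\<^sup>2)"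
    by (simp add: norm_vec_power2 inv)
  also have "\<dots> = (\<Sum>c\<in>{0..<n1}. \<Sum>r\<in>{0..<n2}. h c r)"
    unfolding h_def by (rule sum_pixels[OF x])
  finally have v: "(norm v)\<^sup>2 = (\<Sum>c\<in>{0..<n1}. \<Sum>r\<in>{0..<n2}. h c r)" .
  have E: "(\<Sum>i\<in>UNIV. (extend b (n1, n2) x v (x i - z))\<^sup>2) = (\<Sum>c\<in>{0..<n1}. \<Sum>r\<in>{0..<n2}.
      extend1 b n1 (\<lambda>c. extend1 b n2 (h c) (r - snd z)) (c - fst z))" for z
    by (subst sum_pixels[OF x]) (simp add: extend_eq_extend1[OF x] extend1_power2 h_def[abs_def])
  have "(\<Sum>l\<in>UNIV. ?K (g l) * (\<Sum>i\<in>UNIV. (extend b (n1, n2) x v (x i - g l))\<^sup>2))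
      = (\<Sum>z\<in>patch LK. ?K z * (\<Sum>i\<in>UNIV. (extend b (n1, n2) x v (x i - z))\<^sup>2))"
    by (rule sum.reindex_bij_betw[OF g])
  also have "\<dots> = (\<Sum>s\<in>?A. \<Sum>t\<in>?A. ?K (s, t) * (\<Sum>c\<in>{0..<n1}. \<Sum>r\<in>{0..<n2}.
      extend1 b n1 (\<lambda>c. extend1 b n2 (h c) (r - t)) (c - s)))"
    unfolding E patch_def by (simp add: sum.cartesian_product case_prod_unfold)
  also have "\<dots> \<le> (\<Sum>s\<in>?A. \<Sum>t\<in>?A. ?K (s, t)) * (\<Sum>c\<in>{0..<n1}. \<Sum>r\<in>{0..<n2}. h c r)"
    using pixel_grid_nonempty[OF x] patch_kernel_nonneg[OF \<rho>] patch_kernel_even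
    by (intro sum_even_weight_extend1_2d_le) (auto simp: h_def)
  also have "(\<Sum>s\<in>?A. \<Sum>t\<in>?A. ?K (s, t)) = 1"
    using sum_patch_kernel[OF \<rho>, of LK] by (simp add: sum.cartesian_product patch_def)
  finally show ?thesis by (simp add: v)
qed

text \<open>
  One factor \<open>4\<close> for each of the two directions: a step along one coordinate stays inside the grid in
  the other, so the one-dimensional estimate applies in every row and in every column.
\<close>

lemma norm_dgrad_le:
  fixes v :: "real^'n::finite" and x :: "'n \<Rightarrow> int \<times> int"
  assumes x: "bij_betw x UNIV ({0..<n1} \<times> {0..<n2})"
  shows "(\<Sum>i\<in>UNIV. \<Sum>c\<in>UNIV. (dgrad (extend b (n1, n2) x) x v $ i $ c)\<^sup>2) \<le> 8 * (norm v)\<^sup>2"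
proof -
  let ?C = "{0..<n1}" and ?R = "{0..<n2}"
  define h where "h c r = v $ inv x (c, r)" for c r
  have n: "n1 > 0" "n2 > 0" by (rule pixel_grid_nonempty[OF x])+
  have inv: "v $ i = (case x i of (c, r) \<Rightarrow> h c r)" for i
    using x by (simp add: h_def bij_betw_def inv_f_f)
  have inside: "extend1 b n a z = a z" if "z \<in> {0..<n}" for a n z
    using that by (cases b) (simp_all add: extend1_def mod_pos_pos_trivial)
  have E: "extend b (n1, n2) x v (c, r) = extend1 b n1 (\<lambda>c. extend1 b n2 (h c) r) c" for c r
    by (simp add: extend_eq_extend1[OF x] h_def[abs_def])
  have cols: "extend b (n1, n2) x v (c, r) = extend1 b n1 (\<lambda>c. h c r) c" if "r \<in> ?R" for c r
    using that by (simp add: E inside)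
  have rows: "extend b (n1, n2) x v (c, r) = extend1 b n2 (h c) r" if "c \<in> ?C" for c r
    using that by (simp add: E inside)
  have v: "(norm v)\<^sup>2 = (\<Sum>c\<in>?C. \<Sum>r\<in>?R. (h c r)\<^sup>2)"
    unfolding norm_vec_power2 inv by (subst sum_pixels[OF x]) simp
  have "(\<Sum>i\<in>UNIV. (extend b (n1, n2) x v (x i + (1, 0)) - v $ i)\<^sup>2)
      = (\<Sum>c\<in>?C. \<Sum>r\<in>?R. (extend b (n1, n2) x v (c + 1, r) - h c r)\<^sup>2)"
    unfolding inv by (subst sum_pixels[OF x]) simp
  also have "\<dots> = (\<Sum>r\<in>?R. \<Sum>c\<in>?C. (extend1 b n1 (\<lambda>c. h c r) (c + 1) - h c r)\<^sup>2)"
    by (subst sum.swap) (intro sum.cong, auto simp: cols)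
  also have "\<dots> \<le> (\<Sum>r\<in>?R. 4 * (\<Sum>c\<in>?C. (h c r)\<^sup>2))"
    using n by (intro sum_mono sum_extend1_forward_diff_le)
  also have "\<dots> = 4 * (norm v)\<^sup>2"
    unfolding v by (simp add: sum_distrib_left sum.swap[of _ ?R ?C])
  finally have 1: "(\<Sum>i\<in>UNIV. (extend b (n1, n2) x v (x i + (1, 0)) - v $ i)\<^sup>2) \<le> 4 * (norm v)\<^sup>2" .
  have "(\<Sum>i\<in>UNIV. (extend b (n1, n2) x v (x i + (0, 1)) - v $ i)\<^sup>2)
      = (\<Sum>c\<in>?C. \<Sum>r\<in>?R. (extend b (n1, n2) x v (c, r + 1) - h c r)\<^sup>2)"
    unfolding inv by (subst sum_pixels[OF x]) simp
  also have "\<dots> = (\<Sum>c\<in>?C. \<Sum>r\<in>?R. (extend1 b n2 (h c) (r + 1) - h c r)\<^sup>2)"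
    by (intro sum.cong) (auto simp: rows)
  also have "\<dots> \<le> (\<Sum>c\<in>?C. 4 * (\<Sum>r\<in>?R. (h c r)\<^sup>2))"
    using n by (intro sum_mono sum_extend1_forward_diff_le)
  also have "\<dots> = 4 * (norm v)\<^sup>2"
    unfolding v by (simp add: sum_distrib_left)
  finally have "(\<Sum>i\<in>UNIV. (extend b (n1, n2) x v (x i + (0, 1)) - v $ i)\<^sup>2) \<le> 4 * (norm v)\<^sup>2" .
  with 1 show ?thesis
    by (simp add: dgrad_def sum_2 sum.distrib)
qed

lemma weight_power2_le_1:
  assumes "\<kappa> \<ge> 0"
  shows "(weight \<kappa> \<rho> Ed Ef x v $ i $ c)\<^sup>2 \<le> 1"
proof -
  have "0 \<le> \<kappa> * \<bar>smooth \<rho> Ef x (component (dgrad Ed x v) c) $ i\<bar>"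
    using assms by simp
  then show ?thesis
    by (simp add: weight_def power_le_one_iff divide_simps)
qed

text \<open>
  The bound \<open>8\<close> for the squared norm comes from the differences alone: the patch average does not
  increase the norm, and the weights are at most \<open>1\<close>.
\<close>

lemma norm_wjacobian_le:
  fixes x :: "'n::finite \<Rightarrow> int \<times> int" and g :: "'l::finite \<Rightarrow> int \<times> int"
    and f u :: "real^'n^'m::finite"
  assumes x: "bij_betw x UNIV ({0..<n1} \<times> {0..<n2})"
    and g: "bij_betw g UNIV (patch LK)" and \<rho>: "\<rho> > 0" and \<kappa>: "\<kappa> \<ge> 0"
  shows "norm (wjacobian \<kappa> \<sigma> (patch_kernel \<rho> LK) g
           (extend bd (n1, n2) x) (extend bf (n1, n2) x) x f u) \<le> sqrt 8 * norm u"
proof -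
  let ?K = "patch_kernel \<rho> LK"
  let ?Ed = "extend bd (n1, n2) x" and ?Ef = "extend bf (n1, n2) x"
  let ?J = "wjacobian \<kappa> \<sigma> ?K g ?Ed ?Ef x f"
  define D where "D m = dgrad ?Ed x (u $ m)" for m
  define W where "W m = weight \<kappa> \<sigma> ?Ed ?Ef x (f $ m)" for m
  define F where "F m = apply_weight (W m) (D m)" for m
  have entry: "(?J u $ i $ (m, l) $ c)\<^sup>2 = ?K (g l) * (?Ef (component (F m) c) (x i - g l))\<^sup>2" for i m l c
    using patch_kernel_nonneg[OF \<rho>]
    by (simp add: wjacobian_def wtranslate_def F_def W_def D_def power_mult_distrib)
  have pairs: "(\<Sum>(m, l)\<in>UNIV. \<phi> m l) = (\<Sum>m\<in>UNIV. \<Sum>l\<in>UNIV. \<phi> m l)" for \<phi> :: "'m \<Rightarrow> 'l \<Rightarrow> real"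
    by (simp add: sum.cartesian_product)
  have "(norm (?J u))\<^sup>2 = (\<Sum>i\<in>UNIV. \<Sum>(m, l)\<in>UNIV. \<Sum>c\<in>UNIV. (?J u $ i $ (m, l) $ c)\<^sup>2)"
    by (simp only: power2_norm_eq_inner inner_vec_def) (simp add: power2_eq_square case_prod_unfold)
  also have "\<dots> = (\<Sum>i\<in>UNIV. \<Sum>m\<in>UNIV. \<Sum>l\<in>UNIV. \<Sum>c\<in>UNIV. ?K (g l) * (?Ef (component (F m) c) (x i - g l))\<^sup>2)"
    by (simp add: entry pairs)
  also have "\<dots> = (\<Sum>m\<in>UNIV. \<Sum>c\<in>UNIV. \<Sum>l\<in>UNIV. ?K (g l) * (\<Sum>i\<in>UNIV. (?Ef (component (F m) c) (x i - g l))\<^sup>2))"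
    by (simp add: sum_distrib_left sum.swap[of _ "UNIV :: 'm set" "UNIV :: 'n set"]
        sum.swap[of _ "UNIV :: 'l set" "UNIV :: 'n set"] sum.swap[of _ "UNIV :: 2 set" "UNIV :: 'n set"]
        sum.swap[of _ "UNIV :: 2 set" "UNIV :: 'l set"])
  also have "\<dots> \<le> (\<Sum>m\<in>UNIV. \<Sum>c\<in>UNIV. (norm (component (F m) c))\<^sup>2)"
    by (intro sum_mono sum_patch_translations_le[OF x g \<rho>])
  also have "\<dots> = (\<Sum>m\<in>UNIV. \<Sum>i\<in>UNIV. \<Sum>c\<in>UNIV. (W m $ i $ c)\<^sup>2 * (D m $ i $ c)\<^sup>2)"
    unfolding norm_vec_power2 F_def
    by (subst sum.swap[of _ "UNIV :: 2 set"]) (simp add: component_def apply_weight_def power_mult_distrib)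
  also have "\<dots> \<le> (\<Sum>m\<in>UNIV. \<Sum>i\<in>UNIV. \<Sum>c\<in>UNIV. 1 * (D m $ i $ c)\<^sup>2)"
    unfolding W_def by (intro sum_mono mult_right_mono weight_power2_le_1[OF \<kappa>]) auto
  also have "\<dots> \<le> (\<Sum>m\<in>UNIV. 8 * (norm (u $ m))\<^sup>2)"
    unfolding D_def mult_1 by (intro sum_mono norm_dgrad_le[OF x])
  also have "\<dots> = 8 * (norm u)\<^sup>2"
    by (simp add: power2_norm_eq_inner inner_vec_def sum_distrib_left)
  finally have "(norm (?J u))\<^sup>2 \<le> (sqrt 8 * norm u)\<^sup>2"
    by (simp add: power_mult_distrib)
  then show ?thesis by (rule power2_le_imp_le) simp
qed

text \<open>
  The weights are computed from \<open>f\<close> and not from the argument, so the Jacobian is linear.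
\<close>

lemma linear_wjacobian:
  "linear (wjacobian \<kappa> \<sigma> K g (extend bd dims x) (extend bf dims x) x f)"
proof -
  have "wjacobian \<kappa> \<sigma> K g (extend bd dims x) (extend bf dims x) x f (u + v) $ i $ h $ c
      = wjacobian \<kappa> \<sigma> K g (extend bd dims x) (extend bf dims x) x f u $ i $ h $ c
      + wjacobian \<kappa> \<sigma> K g (extend bd dims x) (extend bf dims x) x f v $ i $ h $ c" for u v i h c
    using exhaust_2[of c]
    by (cases h) (auto simp: wjacobian_def wtranslate_def apply_weight_def component_def dgrad_def
        extend_def Let_def algebra_simps)
  moreover have "wjacobian \<kappa> \<sigma> K g (extend bd dims x) (extend bf dims x) x f (r *\<^sub>R u) $ i $ h $ c
      = r * wjacobian \<kappa> \<sigma> K g (extend bd dims x) (extend bf dims x) x f u $ i $ h $ c" for r u i h c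
    using exhaust_2[of c]
    by (cases h) (auto simp: wjacobian_def wtranslate_def apply_weight_def component_def dgrad_def
        extend_def Let_def algebra_simps)
  ultimately show ?thesis
    by (intro linearI) (simp_all add: vec_eq_iff)
qed

section \<open>Duality for a linear operator between Euclidean spaces\<close>

text \<open>
  Completing the square: minimising the Lagrangian over \<open>C\<close> means projecting
  \<open>f - \<tau> *\<^sub>R adjoint J \<Phi>\<close> onto \<open>C\<close>.
\<close>

lemma lagrangian_complete_square:
  "lagrangian J \<tau> f \<Phi> u = 1 / 2 * (norm (u - (f - \<tau> *\<^sub>R adjoint J \<Phi>)))\<^sup>2
     + 1 / 2 * (norm f)\<^sup>2 - 1 / 2 * (norm (f - \<tau> *\<^sub>R adjoint J \<Phi>))\<^sup>2"
  by (simp add: lagrangian_def power2_norm_eq_inner algebra_simps inner_commute)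

lemma closest_point_minimizes_lagrangian:
  assumes "closed C" "C \<noteq> {}"
  shows "is_arg_min (lagrangian J \<tau> f \<Phi>) (\<lambda>u. u \<in> C) (closest_point C (f - \<tau> *\<^sub>R adjoint J \<Phi>))"
proof -
  let ?s = "f - \<tau> *\<^sub>R adjoint J \<Phi>"
  have "norm (closest_point C ?s - ?s) \<le> norm (u - ?s)" if "u \<in> C" for u
    using closest_point_le[OF assms(1) that, of ?s] by (simp add: dist_norm norm_minus_commute)
  then have "(norm (closest_point C ?s - ?s))\<^sup>2 \<le> (norm (u - ?s))\<^sup>2" if "u \<in> C" for u
    using that by (simp add: power_mono)
  then show ?thesis
    using closest_point_in_set[OF assms]
    by (force simp: is_arg_min_linorder lagrangian_complete_square)
qed

lemma dual_objective_attained: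
  assumes "is_arg_min (lagrangian J \<tau> f \<Phi>) (\<lambda>u. u \<in> C) u"
  shows "dual_objective J \<tau> f C \<Phi> = lagrangian J \<tau> f \<Phi> u"
  unfolding dual_objective_def
  by (rule cInf_eq_minimum) (use assms in \<open>auto simp: is_arg_min_linorder\<close>)

lemma dual_objective_le_lagrangian:
  assumes "closed C" "u \<in> C"
  shows "dual_objective J \<tau> f C \<Phi> \<le> lagrangian J \<tau> f \<Phi> u"
proof -
  have "C \<noteq> {}" using assms by auto
  then have *: "is_arg_min (lagrangian J \<tau> f \<Phi>) (\<lambda>u. u \<in> C) (closest_point C (f - \<tau> *\<^sub>R adjoint J \<Phi>))"
    by (rule closest_point_minimizes_lagrangian[OF assms(1)])
  then show ?thesis
    using assms(2) by (auto simp: dual_objective_attained[OF *] is_arg_min_linorder)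
qed

lemma lagrangian_affine:
  assumes "linear J" and "a + b = 1"
  shows "lagrangian J \<tau> f (a *\<^sub>R \<Phi> + b *\<^sub>R \<Psi>) u = a * lagrangian J \<tau> f \<Phi> u + b * lagrangian J \<tau> f \<Psi> u"
proof -
  let ?N = "1 / 2 * (norm (u - f))\<^sup>2"
  have "adjoint J (a *\<^sub>R \<Phi> + b *\<^sub>R \<Psi>) \<bullet> u = a * (adjoint J \<Phi> \<bullet> u) + b * (adjoint J \<Psi> \<bullet> u)"
    using adjoint_linear[OF assms(1)] by (simp add: linear_add linear_cmul inner_add_left)
  moreover have "?N = a * ?N + b * ?N"
    using assms(2) by (simp flip: distrib_right)
  ultimately show ?thesis
    unfolding lagrangian_def by (simp only: distrib_left mult.left_commute)
qed

text \<open>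
  For a fixed \<open>u\<close> the Lagrangian is affine in \<open>\<Phi>\<close>, and an infimum of affine functions is concave.
\<close>

lemma concave_dual_objective:
  fixes J :: "'a::euclidean_space \<Rightarrow> 'b::euclidean_space"
  assumes J: "linear J" and C: "closed C" "C \<noteq> {}"
  shows "concave_on UNIV (dual_objective J \<tau> f C)"
  unfolding concave_on_iff
proof (intro conjI ballI allI impI)
  fix \<Phi> \<Psi> :: 'b and a b :: real
  assume ab: "a \<ge> 0" "b \<ge> 0" "a + b = 1"
  let ?d = "dual_objective J \<tau> f C"
  let ?\<Theta> = "a *\<^sub>R \<Phi> + b *\<^sub>R \<Psi>"
  obtain u where u: "is_arg_min (lagrangian J \<tau> f ?\<Theta>) (\<lambda>u. u \<in> C) u"
    using closest_point_minimizes_lagrangian[OF C] by blast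
  then have "u \<in> C" by (simp add: is_arg_min_def)
  then have "a * ?d \<Phi> + b * ?d \<Psi> \<le> a * lagrangian J \<tau> f \<Phi> u + b * lagrangian J \<tau> f \<Psi> u"
    using ab dual_objective_le_lagrangian[OF C(1)] by (intro add_mono mult_left_mono) auto
  also have "\<dots> = ?d ?\<Theta>"
    by (simp add: dual_objective_attained[OF u] lagrangian_affine[OF J ab(3)])
  finally show "?d ?\<Theta> \<ge> a * ?d \<Phi> + b * ?d \<Psi>" .
qed auto

lemma norm_adjoint_le:
  fixes J :: "'a::euclidean_space \<Rightarrow> 'b::euclidean_space"
  assumes J: "linear J" and B: "\<And>u. norm (J u) \<le> B * norm u" "B \<ge> 0"
  shows "norm (adjoint J \<Phi>) \<le> B * norm \<Phi>"
proof (cases "adjoint J \<Phi> = 0")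
  case False
  have "norm (adjoint J \<Phi>) * norm (adjoint J \<Phi>) = adjoint J \<Phi> \<bullet> adjoint J \<Phi>"
    by (simp add: power2_norm_eq_inner flip: power2_eq_square)
  also have "\<dots> = J (adjoint J \<Phi>) \<bullet> \<Phi>"
    by (simp add: adjoint_works[OF J])
  also have "\<dots> \<le> norm (J (adjoint J \<Phi>)) * norm \<Phi>"
    by (rule norm_cauchy_schwarz)
  also have "\<dots> \<le> (B * norm \<Phi>) * norm (adjoint J \<Phi>)"
    using mult_right_mono[OF B(1)[of "adjoint J \<Phi>"], of "norm \<Phi>"] by (simp add: mult_ac)
  finally show ?thesis using False by simp
qed (use B in auto)

text \<open>
  The gradient is the composition of \<open>adjoint J\<close>, a projection, which is nonexpansive because \<open>C\<close> is
  convex, and \<open>J\<close>; each of the two linear maps contributes a factor \<open>B * \<tau>\<close>.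
\<close>

lemma lipschitz_dual_gradient:
  fixes J :: "'a::euclidean_space \<Rightarrow> 'b::euclidean_space"
  assumes J: "linear J" and B: "\<And>u. norm (J u) \<le> B * norm u" "B \<ge> 0" and \<tau>: "\<tau> \<ge> 0"
    and C: "convex C" "closed C" "C \<noteq> {}"
  shows "(B\<^sup>2 * \<tau>\<^sup>2)-lipschitz_on UNIV (dual_gradient J \<tau> f C)"
proof (rule lipschitz_onI)
  fix \<Phi> \<Psi> :: 'b
  let ?s = "\<lambda>\<Phi>. f - \<tau> *\<^sub>R adjoint J \<Phi>"
  let ?P = "closest_point C"
  have "dist (dual_gradient J \<tau> f C \<Phi>) (dual_gradient J \<tau> f C \<Psi>) = \<tau> * norm (J (?P (?s \<Phi>) - ?P (?s \<Psi>)))"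
    using \<tau> by (simp add: dual_gradient_def dist_norm linear_diff[OF J] flip: scaleR_diff_right)
  also have "\<dots> \<le> \<tau> * (B * dist (?s \<Phi>) (?s \<Psi>))"
    using closest_point_lipschitz[OF C, of "?s \<Phi>" "?s \<Psi>"] B(2) \<tau>
    by (intro mult_left_mono order_trans[OF B(1)]) (auto simp: dist_norm)
  also have "?s \<Phi> - ?s \<Psi> = \<tau> *\<^sub>R adjoint J (\<Psi> - \<Phi>)"
    by (simp add: linear_diff[OF adjoint_linear[OF J]] algebra_simps)
  then have "dist (?s \<Phi>) (?s \<Psi>) = \<tau> * norm (adjoint J (\<Psi> - \<Phi>))"
    using \<tau> by (simp only: dist_norm) simp
  also have "\<tau> * (B * (\<tau> * norm (adjoint J (\<Psi> - \<Phi>)))) \<le> \<tau> * (B * (\<tau> * (B * norm (\<Psi> - \<Phi>))))"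
    using \<tau> B(2) by (intro mult_left_mono norm_adjoint_le[OF J B]) auto
  also have "\<dots> = B\<^sup>2 * \<tau>\<^sup>2 * dist \<Phi> \<Psi>"
    by (simp add: dist_norm norm_minus_commute power2_eq_square mult_ac)
  finally show "dist (dual_gradient J \<tau> f C \<Phi>) (dual_gradient J \<tau> f C \<Psi>) \<le> B\<^sup>2 * \<tau>\<^sup>2 * dist \<Phi> \<Psi>" .
qed simp

text \<open>
  Differentiability without differentiating the projection: the supergradient inequality at \<open>\<Phi>\<close>
  bounds the remainder \<open>d \<Psi> - d \<Phi> - (\<Psi> - \<Phi>) \<bullet> G \<Phi>\<close> from above by \<open>0\<close>, the one at \<open>\<Psi>\<close> from below
  by \<open>(\<Psi> - \<Phi>) \<bullet> (G \<Psi> - G \<Phi>)\<close>, which is quadratically small when \<open>G\<close> is Lipschitz continuous.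
\<close>

lemma gderiv_if_supergradient_lipschitz:
  fixes d :: "'b::real_inner \<Rightarrow> real"
  assumes super: "\<And>\<Phi> \<Psi>. d \<Psi> \<le> d \<Phi> + (\<Psi> - \<Phi>) \<bullet> G \<Phi>" and lip: "L-lipschitz_on UNIV G"
  shows "GDERIV d \<Phi> :> G \<Phi>"
  unfolding gderiv_def
proof (rule has_derivativeI_sandwich[where e = 1])
  show "bounded_linear (\<lambda>h. h \<bullet> G \<Phi>)" by (rule bounded_linear_inner_left)
  show "((\<lambda>\<Psi>. L * norm (\<Psi> - \<Phi>)) \<longlongrightarrow> 0) (at \<Phi>)"
    by (auto intro!: tendsto_eq_intros)
  fix \<Psi> assume "\<Psi> \<noteq> \<Phi>"
  have "(\<Psi> - \<Phi>) \<bullet> (G \<Phi> - G \<Psi>) \<le> norm (\<Psi> - \<Phi>) * dist (G \<Phi>) (G \<Psi>)"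
    by (simp add: dist_norm norm_cauchy_schwarz)
  also have "\<dots> \<le> norm (\<Psi> - \<Phi>) * (L * norm (\<Psi> - \<Phi>))"
    using lipschitz_onD[OF lip, of \<Phi> \<Psi>]
    by (intro mult_left_mono) (auto simp: dist_norm norm_minus_commute)
  finally have "(\<Psi> - \<Phi>) \<bullet> (G \<Phi> - G \<Psi>) \<le> L * norm (\<Psi> - \<Phi>) * norm (\<Psi> - \<Phi>)"
    by (simp add: mult_ac)
  moreover have "\<bar>d \<Psi> - d \<Phi> - (\<Psi> - \<Phi>) \<bullet> G \<Phi>\<bar> \<le> (\<Psi> - \<Phi>) \<bullet> (G \<Phi> - G \<Psi>)"
    using super[of \<Psi> \<Phi>] super[of \<Phi> \<Psi>] by (simp add: inner_diff_left inner_diff_right)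
  ultimately have "\<bar>d \<Psi> - d \<Phi> - (\<Psi> - \<Phi>) \<bullet> G \<Phi>\<bar> \<le> L * norm (\<Psi> - \<Phi>) * norm (\<Psi> - \<Phi>)"
    by linarith
  then show "norm (d \<Psi> - d \<Phi> - (\<Psi> - \<Phi>) \<bullet> G \<Phi>) / norm (\<Psi> - \<Phi>) \<le> L * norm (\<Psi> - \<Phi>)"
    using \<open>\<Psi> \<noteq> \<Phi>\<close> by (simp add: divide_simps)
qed simp

text \<open>
  Testing \<open>d \<Psi>\<close> with the minimiser that belongs to \<open>\<Phi>\<close> bounds it by an affine function that
  touches \<open>d\<close> at \<open>\<Phi>\<close> and has the slope \<open>dual_gradient J \<tau> f C \<Phi>\<close>.
\<close>

lemma dual_objective_supergradient:
  fixes J :: "'a::euclidean_space \<Rightarrow> 'b::euclidean_space"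
  assumes J: "linear J" and C: "closed C" "C \<noteq> {}"
  shows "dual_objective J \<tau> f C \<Psi>
       \<le> dual_objective J \<tau> f C \<Phi> + (\<Psi> - \<Phi>) \<bullet> dual_gradient J \<tau> f C \<Phi>"
proof -
  let ?u = "closest_point C (f - \<tau> *\<^sub>R adjoint J \<Phi>)"
  have "dual_objective J \<tau> f C \<Psi> \<le> lagrangian J \<tau> f \<Psi> ?u"
    by (rule dual_objective_le_lagrangian[OF C(1) closest_point_in_set[OF C]])
  also have "\<dots> = lagrangian J \<tau> f \<Phi> ?u + \<tau> * (adjoint J (\<Psi> - \<Phi>) \<bullet> ?u)"
    by (simp add: lagrangian_def linear_diff[OF adjoint_linear[OF J]] inner_diff_left algebra_simps)
  also have "adjoint J (\<Psi> - \<Phi>) \<bullet> ?u = (\<Psi> - \<Phi>) \<bullet> J ?u"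
    by (metis adjoint_works[OF J] inner_commute)
  also have "lagrangian J \<tau> f \<Phi> ?u = dual_objective J \<tau> f C \<Phi>"
    by (rule dual_objective_attained[OF closest_point_minimizes_lagrangian[OF C], symmetric])
  finally show ?thesis by (simp add: dual_gradient_def)
qed

section \<open>Schatten norms of matrices with two columns\<close>

definition col_inner :: "2 \<Rightarrow> 2 \<Rightarrow> real^2^'r \<Rightarrow> real" where
  "col_inner i j A = column i A \<bullet> column j A"

text \<open>
  For a matrix with two columns, \<open>gram_upper\<close> and \<open>gram_lower\<close> are the two eigenvalues of the Gram
  matrix \<open>transpose A ** A\<close>, from the quadratic formula, and \<open>gram_gap\<close>, the root of the discriminant,
  is their difference. The explicit formulas make the continuous dependence on \<open>A\<close> evident, which
  the set of singular values does not.
\<close>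

definition gram_gap :: "real^2^'r \<Rightarrow> real" where
  "gram_gap A = sqrt ((col_inner 1 1 A - col_inner 2 2 A)\<^sup>2 + 4 * (col_inner 1 2 A)\<^sup>2)"

definition gram_upper :: "real^2^'r \<Rightarrow> real" where
  "gram_upper A = (col_inner 1 1 A + col_inner 2 2 A + gram_gap A) / 2"

definition gram_lower :: "real^2^'r \<Rightarrow> real" where
  "gram_lower A = (col_inner 1 1 A + col_inner 2 2 A - gram_gap A) / 2"

lemma gram_eigen_iff:
  fixes A :: "real^2^'r"
  shows "(transpose A ** A) *v v = t *\<^sub>R v \<longleftrightarrow>
    (col_inner 1 1 A - t) * v $ 1 + col_inner 1 2 A * v $ 2 = 0 \<and>
    col_inner 1 2 A * v $ 1 + (col_inner 2 2 A - t) * v $ 2 = 0"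
proof -
  have "(transpose A ** A) $ i $ j = col_inner i j A" for i j
    by (simp add: matrix_matrix_mult_def transpose_def col_inner_def column_def inner_vec_def)
  moreover have "col_inner 2 1 A = col_inner 1 2 A"
    by (simp add: col_inner_def inner_commute)
  ultimately show ?thesis
    by (auto simp: vec_eq_iff matrix_vector_mult_def sum_2 forall_2 algebra_simps)
qed

lemma gram_char_poly:
  fixes A :: "real^2^'r"
  shows "(col_inner 1 1 A - t) * (col_inner 2 2 A - t) - (col_inner 1 2 A)\<^sup>2
       = (t - gram_upper A) * (t - gram_lower A)"
proof -
  have "(gram_gap A)\<^sup>2 = (col_inner 1 1 A - col_inner 2 2 A)\<^sup>2 + 4 * (col_inner 1 2 A)\<^sup>2"
    by (simp add: gram_gap_def)
  then show ?thesis
    unfolding gram_upper_def gram_lower_def by (simp add: field_simps power2_eq_square)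
qed

lemma gram_eigenvalue_iff:
  fixes A :: "real^2^'r"
  shows "(\<exists>v. v \<noteq> 0 \<and> (transpose A ** A) *v v = t *\<^sub>R v) \<longleftrightarrow> t = gram_upper A \<or> t = gram_lower A"
proof -
  define a where "a = col_inner 1 1 A - t"
  define b where "b = col_inner 1 2 A"
  define c where "c = col_inner 2 2 A - t"
  have "(\<exists>v. v \<noteq> 0 \<and> (transpose A ** A) *v v = t *\<^sub>R v) \<longleftrightarrow>
        (\<exists>v::real^2. v \<noteq> 0 \<and> a * v $ 1 + b * v $ 2 = 0 \<and> b * v $ 1 + c * v $ 2 = 0)"
    by (simp add: gram_eigen_iff a_def b_def c_def)
  also have "\<dots> \<longleftrightarrow> a * c - b\<^sup>2 = 0"
  proof
    assume "\<exists>v::real^2. v \<noteq> 0 \<and> a * v $ 1 + b * v $ 2 = 0 \<and> b * v $ 1 + c * v $ 2 = 0"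
    then obtain v :: "real^2" where v: "v \<noteq> 0" "a * v $ 1 + b * v $ 2 = 0" "b * v $ 1 + c * v $ 2 = 0"
      by blast
    have "(a * c - b\<^sup>2) * v $ 1 = c * (a * v $ 1 + b * v $ 2) - b * (b * v $ 1 + c * v $ 2)"
      "(a * c - b\<^sup>2) * v $ 2 = a * (b * v $ 1 + c * v $ 2) - b * (a * v $ 1 + b * v $ 2)"
      by (simp_all add: algebra_simps power2_eq_square)
    with v show "a * c - b\<^sup>2 = 0"
      by (auto simp: vec_eq_iff forall_2)
  next
    assume det: "a * c - b\<^sup>2 = 0"
    show "\<exists>v::real^2. v \<noteq> 0 \<and> a * v $ 1 + b * v $ 2 = 0 \<and> b * v $ 1 + c * v $ 2 = 0"
    proof (cases "a = 0 \<and> b = 0")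
      case True
      then show ?thesis
        by (intro exI[of _ "vector [1, 0]"]) (auto simp: vec_eq_iff forall_2)
    next
      case False
      \<comment> \<open>Orthogonal to the row \<open>(a, b)\<close>, hence by \<open>det\<close> also to the row \<open>(b, c)\<close>.\<close>
      with det show ?thesis
        by (intro exI[of _ "vector [- b, a]"])
           (auto simp: vec_eq_iff forall_2 power2_eq_square algebra_simps)
    qed
  qed
  finally show ?thesis
    by (simp add: a_def b_def c_def gram_char_poly)
qed

text \<open>
  The determinant of the Gram matrix is nonnegative by the Cauchy-Schwarz inequality for the columns.
\<close>

lemma gram_lower_nonneg: "gram_lower (A :: real^2^'r) \<ge> 0"
proof -
  let ?a = "col_inner 1 1 A" and ?b = "col_inner 1 2 A" and ?c = "col_inner 2 2 A"
  have "?b\<^sup>2 \<le> ?a * ?c"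
    unfolding col_inner_def by (rule Cauchy_Schwarz_ineq)
  then have "(?a - ?c)\<^sup>2 + 4 * ?b\<^sup>2 \<le> (?a + ?c)\<^sup>2"
    by (simp add: power2_eq_square algebra_simps)
  moreover have "?a + ?c \<ge> 0" by (simp add: col_inner_def)
  ultimately have "gram_gap A \<le> ?a + ?c"
    unfolding gram_gap_def by (intro real_le_lsqrt) auto
  then show ?thesis by (simp add: gram_lower_def)
qed

lemma gram_lower_le_upper: "gram_lower A \<le> gram_upper A"
  by (simp add: gram_lower_def gram_upper_def gram_gap_def)

lemma singular_values_2:
  fixes A :: "real^2^'r"
  shows "singular_values A = {sqrt (gram_upper A), sqrt (gram_lower A)}"
proof -
  have "0 \<le> gram_lower A" "0 \<le> gram_upper A"
    using gram_lower_nonneg[of A] gram_lower_le_upper[of A] by linarith+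
  then have "(0 \<le> s \<and> (s\<^sup>2 = gram_upper A \<or> s\<^sup>2 = gram_lower A)) \<longleftrightarrow>
      s = sqrt (gram_upper A) \<or> s = sqrt (gram_lower A)" for s
    by (auto simp: real_sqrt_unique)
  then show ?thesis
    unfolding singular_values_def gram_eigenvalue_iff by auto
qed

text \<open>
  In the plane an eigenspace has dimension \<open>1\<close> unless it is everything, and it is everything only for
  a multiple of the identity, that is when the discriminant vanishes. Multiplicities therefore jump
  exactly where the two singular values merge, so that the weighted sum in \<open>schatten_norm\<close> stays
  the sum over the two eigenvalues.
\<close>

lemma dim_gram_eigenspace:
  fixes A :: "real^2^'r"
  assumes "t = gram_upper A \<or> t = gram_lower A"
  shows "dim {v. (transpose A ** A) *v v = t *\<^sub>R v} = (if gram_upper A = gram_lower A then 2 else 1)"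
proof -
  define E where "E = {v. (transpose A ** A) *v v = t *\<^sub>R v}"
  have sub: "subspace E"
    by (auto simp: E_def subspace_def matrix_vector_right_distrib scaleR_right_distrib
        matrix_vector_mult_scaleR)
  obtain v where "v \<noteq> 0" "v \<in> E"
    using assms gram_eigenvalue_iff[of A t] by (auto simp: E_def)
  then have "dim E > 0" by (auto simp: dim_eq_0 simp flip: neq0_conv)
  moreover have "dim E \<le> 2"
    using dim_subset_UNIV[of E] by simp
  moreover have "dim E = 2 \<longleftrightarrow> E = UNIV"
    using dim_eq_full[of E] sub by (simp add: span_eq_iff[THEN iffD2])
  moreover have "E = UNIV \<longleftrightarrow> gram_upper A = gram_lower A"
  proof
    assume "E = UNIV"
    then have "vector [1, 0] \<in> E" "vector [0, 1] \<in> E" by blast+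
    then have "col_inner 1 1 A = t" "col_inner 2 2 A = t" "col_inner 1 2 A = 0"
      by (auto simp: E_def gram_eigen_iff)
    then show "gram_upper A = gram_lower A"
      by (simp add: gram_upper_def gram_lower_def gram_gap_def)
  next
    assume eq: "gram_upper A = gram_lower A"
    then have "gram_gap A = 0" by (simp add: gram_upper_def gram_lower_def)
    then have "col_inner 1 1 A = col_inner 2 2 A" "col_inner 1 2 A = 0"
      by (auto simp: gram_gap_def add_nonneg_eq_0_iff)
    moreover from this eq assms have "t = col_inner 1 1 A"
      by (auto simp: gram_upper_def gram_lower_def gram_gap_def)
    ultimately show "E = UNIV" by (simp add: E_def gram_eigen_iff)
  qed
  ultimately have "0 < dim E" "dim E \<le> 2" "dim E = 2 \<longleftrightarrow> gram_upper A = gram_lower A"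
    by metis+
  then have "dim E = (if gram_upper A = gram_lower A then 2 else 1)"
    by presburger
  then show ?thesis by (simp add: E_def)
qed

lemma schatten_norm_2_infinity:
  fixes A :: "real^2^'r"
  shows "schatten_norm top A = sqrt (gram_upper A)"
  using gram_lower_le_upper[of A] by (simp add: schatten_norm_def singular_values_2 max_def)

lemma schatten_norm_2_finite:
  fixes A :: "real^2^'r"
  assumes "q \<noteq> \<infinity>"
  shows "schatten_norm q A =
    (sqrt (gram_upper A) powr enn2real q + sqrt (gram_lower A) powr enn2real q) powr (1 / enn2real q)"
proof -
  have nn: "0 \<le> gram_lower A" "0 \<le> gram_upper A"
    using gram_lower_nonneg[of A] gram_lower_le_upper[of A] by linarith+
  have "singular_mult A (sqrt t) = (if gram_upper A = gram_lower A then 2 else 1)"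
    if "t = gram_upper A \<or> t = gram_lower A" for t
  proof -
    have "t \<ge> 0" using that nn by auto
    then show ?thesis
      using dim_gram_eigenspace[OF that] by (simp add: singular_mult_def)
  qed
  then have mult: "singular_mult A (sqrt (gram_upper A)) = (if gram_upper A = gram_lower A then 2 else 1)"
    "singular_mult A (sqrt (gram_lower A)) = (if gram_upper A = gram_lower A then 2 else 1)"
    by blast+
  show ?thesis
    using assms mult
    by (cases "gram_upper A = gram_lower A") (simp_all add: schatten_norm_def singular_values_2)
qed

lemma continuous_gram [continuous_intros]:
  "continuous_on UNIV (\<lambda>A::real^2^'r. gram_upper A)"
  "continuous_on UNIV (\<lambda>A::real^2^'r. gram_lower A)"
  unfolding gram_upper_def gram_lower_def gram_gap_def col_inner_def column_def
  by (intro continuous_intros; simp)+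

lemma continuous_schatten_norm_2:
  assumes "q > 0"
  shows "continuous_on UNIV (schatten_norm q :: real^2^'r \<Rightarrow> real)"
proof (cases "q = \<infinity>")
  case True
  then show ?thesis
    by (simp add: schatten_norm_2_infinity[abs_def] continuous_intros)
next
  case False
  then have q: "enn2real q > 0"
    using assms by (simp add: enn2real_positive_iff top.not_eq_extremum)
  have "0 \<le> gram_lower A" "0 \<le> gram_upper A" for A :: "real^2^'r"
    using gram_lower_nonneg[of A] gram_lower_le_upper[of A] by linarith+
  then show ?thesis
    unfolding schatten_norm_2_finite[OF False, abs_def] using q
    by (intro continuous_on_powr' continuous_on_add continuous_on_real_sqrt continuous_gram
        continuous_on_const) (auto intro: add_nonneg_nonneg)
qed

text \<open>
  Both singular values are at most \<open>1\<close>, and their squares add up to the squared Frobenius norm.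
\<close>

lemma norm_le_schatten_norm_2:
  fixes A :: "real^2^'r"
  assumes "schatten_norm q A \<le> 1" "q > 0"
  shows "(norm A)\<^sup>2 \<le> 2"
proof -
  have nn: "0 \<le> gram_lower A" "gram_lower A \<le> gram_upper A" "0 \<le> gram_upper A"
    using gram_lower_nonneg[of A] gram_lower_le_upper[of A] by linarith+
  have "gram_upper A \<le> 1"
  proof (cases "q = \<infinity>")
    case True
    then show ?thesis using assms by (simp add: schatten_norm_2_infinity)
  next
    case False
    define r where "r = enn2real q"
    have r: "r > 0"
      using assms False by (simp add: r_def enn2real_positive_iff top.not_eq_extremum)
    show ?thesis
    proof (rule ccontr)
      assume "\<not> gram_upper A \<le> 1"
      then have "1 < sqrt (gram_upper A) powr r"
        using r by (simp add: gr_one_powr)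
      also have "\<dots> \<le> sqrt (gram_upper A) powr r + sqrt (gram_lower A) powr r"
        by simp
      finally have "1 < schatten_norm q A"
        using r by (simp add: schatten_norm_2_finite[OF False] gr_one_powr flip: r_def)
      with assms show False by simp
    qed
  qed
  moreover have "(norm A)\<^sup>2 = gram_upper A + gram_lower A"
    unfolding gram_upper_def gram_lower_def col_inner_def column_def power2_norm_eq_inner
    by (simp add: inner_vec_def sum_2 sum.distrib field_simps)
  ultimately show ?thesis using nn by linarith
qed

lemma compact_schatten_ball_2:
  assumes "q > 0"
  shows "compact (schatten_ball q :: (real^2^'r^'n) set)"
proof -
  have "closed (schatten_ball q :: (real^2^'r^'n) set)"
    unfolding schatten_ball_def
    by (intro closed_Collect_all closed_Collect_le continuous_on_const
        continuous_on_compose2[OF continuous_schatten_norm_2[OF assms]] continuous_intros) auto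
  moreover have "bounded (schatten_ball q :: (real^2^'r^'n) set)"
  proof (rule boundedI)
    fix \<Phi> :: "real^2^'r^'n"
    assume \<Phi>: "\<Phi> \<in> schatten_ball q"
    have "norm \<Phi> \<le> (\<Sum>n\<in>UNIV. norm (\<Phi> $ n))"
      by (simp add: norm_vec_def L2_set_le_sum)
    also have "\<dots> \<le> (\<Sum>n\<in>(UNIV :: 'n set). sqrt 2)"
      using \<Phi> assms by (intro sum_mono real_le_rsqrt norm_le_schatten_norm_2[of q])
        (auto simp: schatten_ball_def)
    finally show "norm \<Phi> \<le> CARD('n) * sqrt 2" by simp
  qed
  ultimately show ?thesis by (simp add: compact_eq_bounded_closed)
qed

lemma zero_in_schatten_ball_2: "(0 :: real^2^'r^'n) \<in> schatten_ball q"
proof -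
  have "gram_upper (0 :: real^2^'r) = 0" "gram_lower (0 :: real^2^'r) = 0"
    by (simp_all add: gram_upper_def gram_lower_def gram_gap_def col_inner_def column_def inner_vec_def)
  then show ?thesis
    by (cases "q = \<infinity>") (simp_all add: schatten_ball_def schatten_norm_2_infinity schatten_norm_2_finite)
qed

section \<open>Properties of the dual problem\<close>

theorem theorem1:
  fixes f :: "real^'n^'m"
    and C :: "(real^'n^'m) set"
    and x :: "'n \<Rightarrow> int \<times> int" and n1 n2 :: int
    and bd bf :: boundary
    and L\<^sub>K :: nat and g :: "'l::finite \<Rightarrow> int \<times> int"
    and \<kappa> \<sigma> \<rho> \<tau> :: real
    and p q :: ennreal
    and J :: "real^'n^'m \<Rightarrow> real^2^('m \<times> 'l)^'n"
    and d :: "real^2^('m \<times> 'l)^'n \<Rightarrow> real"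
  assumes pixels: "bij_betw x UNIV ({0..<n1} \<times> {0..<n2})"
    and shifts: "bij_betw g UNIV (patch L\<^sub>K)"
    and params: "\<kappa> \<ge> 0" "\<sigma> > 0" "\<rho> > 0" "\<tau> \<ge> 0"
    and exponents: "p \<ge> 1" "1 / p + 1 / q = 1"
    and constraints: "convex C" "closed C" "C \<noteq> {}"
    and J_eq: "J = wjacobian \<kappa> \<sigma> (patch_kernel \<rho> L\<^sub>K) g
                     (extend bd (n1, n2) x) (extend bf (n1, n2) x) x f"
    and d_eq: "d = dual_objective J \<tau> f C"
  shows "(\<forall>\<Phi>. (\<exists>u. is_arg_min (lagrangian J \<tau> f \<Phi>) (\<lambda>u. u \<in> C) u \<and> d \<Phi> = lagrangian J \<tau> f \<Phi> u) \<and>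
           (let s = f - \<tau> *\<^sub>R adjoint J \<Phi> in
              d \<Phi> = 1 / 2 * (norm (s - closest_point C s))\<^sup>2 + 1 / 2 * (norm f)\<^sup>2 - 1 / 2 * (norm s)\<^sup>2)) \<and>
         concave_on UNIV d \<and>
         ((\<forall>\<Phi>. GDERIV d \<Phi> :> dual_gradient J \<tau> f C \<Phi>) \<and>
          (8 * sqrt 2 * \<tau>\<^sup>2)-lipschitz_on UNIV (dual_gradient J \<tau> f C)) \<and>
         {\<Phi>. is_arg_max d (\<lambda>\<Phi>. \<Phi> \<in> schatten_ball q) \<Phi>} \<noteq> {}"
proof -
  have J: "linear J"
    unfolding J_eq by (rule linear_wjacobian)
  have J_norm: "norm (J u) \<le> sqrt 8 * norm u" for u
    unfolding J_eq by (rule norm_wjacobian_le[OF pixels shifts params(3,1)])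
  have lip: "(8 * \<tau>\<^sup>2)-lipschitz_on UNIV (dual_gradient J \<tau> f C)"
    using lipschitz_dual_gradient[OF J J_norm _ params(4) constraints] by simp
  have gderiv: "GDERIV d \<Phi> :> dual_gradient J \<tau> f C \<Phi>" for \<Phi>
    unfolding d_eq
    by (rule gderiv_if_supergradient_lipschitz[OF dual_objective_supergradient[OF J constraints(2,3)] lip])
  have "8 * \<tau>\<^sup>2 \<le> 8 * sqrt 2 * \<tau>\<^sup>2"
    by (intro mult_right_mono) auto
  with lip have "(8 * sqrt 2 * \<tau>\<^sup>2)-lipschitz_on UNIV (dual_gradient J \<tau> f C)"
    by (rule lipschitz_on_le)
  moreover have "\<exists>u. is_arg_min (lagrangian J \<tau> f \<Phi>) (\<lambda>u. u \<in> C) u \<and> d \<Phi> = lagrangian J \<tau> f \<Phi> u"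
    for \<Phi>
    using closest_point_minimizes_lagrangian[OF constraints(2,3)] dual_objective_attained
    unfolding d_eq by blast
  moreover have "let s = f - \<tau> *\<^sub>R adjoint J \<Phi> in
      d \<Phi> = 1 / 2 * (norm (s - closest_point C s))\<^sup>2 + 1 / 2 * (norm f)\<^sup>2 - 1 / 2 * (norm s)\<^sup>2" for \<Phi>
    unfolding d_eq Let_def
      dual_objective_attained[OF closest_point_minimizes_lagrangian[OF constraints(2,3)]]
      lagrangian_complete_square
    by (simp add: norm_minus_commute)
  moreover have "concave_on UNIV d"
    unfolding d_eq by (rule concave_dual_objective[OF J constraints(2,3)])
  moreover have "\<exists>\<Phi>. is_arg_max d (\<lambda>\<Phi>. \<Phi> \<in> schatten_ball q) \<Phi>"
  proof -
    \<comment> \<open>The exponent \<open>q = 0\<close> is impossible because \<open>1 / 0 = \<infinity>\<close> in \<open>ennreal\<close>.\<close>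
    have "q > 0"
      using exponents(2) by (cases "q = 0") (auto simp: zero_less_iff_neq_zero)
    then have "compact (schatten_ball q :: (real^2^('m \<times> 'l)^'n) set)"
      by (rule compact_schatten_ball_2)
    moreover have "continuous_on (schatten_ball q) d"
      using gderiv unfolding gderiv_def
      by (intro continuous_at_imp_continuous_on ballI has_derivative_continuous) blast
    ultimately obtain \<Phi> where "\<Phi> \<in> schatten_ball q" "\<And>\<Psi>. \<Psi> \<in> schatten_ball q \<Longrightarrow> d \<Psi> \<le> d \<Phi>"
      using continuous_attains_sup[of "schatten_ball q" d] zero_in_schatten_ball_2 by blast
    then show ?thesis
      by (auto simp: is_arg_max_linorder)
  qed
  ultimately show ?thesis
    using gderiv by blast
qed

end
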